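(* Let $A, B$ be two non-empty weakly compact convex subsets of a Banach space $X$. If $(A,B)$ is a sharp proximinal pair having weak proximal normal structure, then $(A,B)$ has the weak best proximity pair property (WBPP), i.e. every relatively orbital nonexpansive mapping $T:A\cup B\to A\cup B$ has a best proximity pair.
   Context: Let $X$ be a Banach space and $A,B\subseteq X$ non-empty. Notation: $d(A,B)=\inf\{\|x-y\|:x\in A,\ y\in B\}$; for a point $x$ and a non-empty set $S$, $\delta(x,S)=\sup\{\|x-y\|:y\in S\}$; $\delta(A,B)=\sup\{\|x-y\|:x\in A,\ y\in B\}$. A property such as closed, convex, weakly compact holds for a pair when it holds for both sets; "$(H_1,H_2)$ is a pair of subsets of $(A,B)$" means $H_1\subseteq A$, $H_2\subseteq B$. The pair $(A,B)$ is proximinal if for every $x\in A$ there is $y\in B$ with $\|x-y\|=d(A,B)$, and for every $x\in B$ there is $y\in A$ with $\|x-y\|=d(A,B)$. It is sharp proximinal if in each case such a $y$ is moreover unique. The pair $(A,B)$ has weak proximal normal structure if $(A,B)$ is convex and for every non-empty weakly compact convex proximinal pair $(H_1,H_2)$ of subsets of $(A,B)$ with $d(H_1,H_2)=d(A,B)$ and $\delta(H_1,H_2)>d(H_1,H_2)$, there exists $(x,y)\in H_1\times H_2$ such that $\delta(x,H_2)<\delta(H_1,H_2)$ and $\delta(y,H_1)<\delta(H_1,H_2)$. A map $T:A\cup B\to A\cup B$ is cyclic if $T(A)\subseteq B$ and $T(B)\subseteq A$. For $x\in A\cup B$, $\mathcal{O}^2(x)=\{T^{2n}x:n\in\mathbb{N}\cup\{0\}\}$,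 and $r_x(\mathcal{O}^2(y))=\delta(x,\mathcal{O}^2(y))=\sup_{n\ge 0}\|x-T^{2n}y\|$. A cyclic map $T:A\cup B\to A\cup B$ is relatively orbital nonexpansive if (i) for $x\in A$, $y\in B$, $\|x-y\|=d(A,B)$ implies $\|Tx-Ty\|=d(A,B)$; and (ii) for all $x\in A$, $y\in B$, $\|Tx-Ty\|\le\min\{r_x(\mathcal{O}^2(y)),\,r_y(\mathcal{O}^2(x))\}$. A best proximity pair for a cyclic map $T$ on $A\cup B$ is a pair $(x,y)\in A\times B$ with $\|x-Tx\|=\|y-Ty\|=d(A,B)$. *)

theory Defs
  imports "HOL-Analysis.Analysis"
begin

definition weak_topology :: "'a::real_normed_vector topology" where
  "weak_topology =
    topology_generated_by {f -` U | (f :: 'a \<Rightarrow> real) U. bounded_linear f \<and> open U}"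

definition weakly_compact :: "'a::real_normed_vector set \<Rightarrow> bool" where
  "weakly_compact S \<longleftrightarrow> compactin weak_topology S"

text \<open>
  The distance \<open>d(A,B)\<close> of two non-empty sets is \<^const>\<open>setdist\<close>. The suprema
  \<open>\<delta>(x,S)\<close> and \<open>\<delta>(A,B)\<close> are extended reals, so that they are meaningful for unbounded
  sets as well.
\<close>

definition delta_pt :: "'a::real_normed_vector \<Rightarrow> 'a set \<Rightarrow> ereal" where
  "delta_pt x S = (SUP y\<in>S. ereal (norm (x - y)))"

definition delta :: "'a::real_normed_vector set \<Rightarrow> 'a set \<Rightarrow> ereal" where
  "delta A B = (SUP (x, y)\<in>A \<times> B. ereal (norm (x - y)))"

definition proximinal_pair :: "'a::real_normed_vector set \<Rightarrow> 'a set \<Rightarrow> bool" where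
  "proximinal_pair A B \<longleftrightarrow>
    (\<forall>x\<in>A. \<exists>y\<in>B. norm (x - y) = setdist A B) \<and>
    (\<forall>x\<in>B. \<exists>y\<in>A. norm (x - y) = setdist A B)"

definition sharp_proximinal_pair :: "'a::real_normed_vector set \<Rightarrow> 'a set \<Rightarrow> bool" where
  "sharp_proximinal_pair A B \<longleftrightarrow>
    (\<forall>x\<in>A. \<exists>!y. y \<in> B \<and> norm (x - y) = setdist A B) \<and>
    (\<forall>x\<in>B. \<exists>!y. y \<in> A \<and> norm (x - y) = setdist A B)"

definition weak_proximal_normal_structure :: "'a::real_normed_vector set \<Rightarrow> 'a set \<Rightarrow> bool" where
  "weak_proximal_normal_structure A B \<longleftrightarrow>
    convex A \<and> convex B \<and>
    (\<forall>H1 H2. H1 \<subseteq> A \<and> H2 \<subseteq> B \<and> H1 \<noteq> {} \<and> H2 \<noteq> {} \<and>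
      weakly_compact H1 \<and> weakly_compact H2 \<and> convex H1 \<and> convex H2 \<and>
      proximinal_pair H1 H2 \<and> setdist H1 H2 = setdist A B \<and>
      delta H1 H2 > ereal (setdist H1 H2) \<longrightarrow>
      (\<exists>x\<in>H1. \<exists>y\<in>H2. delta_pt x H2 < delta H1 H2 \<and> delta_pt y H1 < delta H1 H2))"

text \<open>
  A map \<open>T : A \<union> B \<rightarrow> A \<union> B\<close> is represented by a total function; all notions below depend
  only on its values on \<open>A \<union> B\<close>.
\<close>

definition cyclic_map :: "'a set \<Rightarrow> 'a set \<Rightarrow> ('a \<Rightarrow> 'a) \<Rightarrow> bool" where
  "cyclic_map A B T \<longleftrightarrow> T ` A \<subseteq> B \<and> T ` B \<subseteq> A"

definition orbit2 :: "('a \<Rightarrow> 'a) \<Rightarrow> 'a \<Rightarrow> 'a set" where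
  "orbit2 T x = {(T ^^ (2 * n)) x | n. True}"

definition relatively_orbital_nonexpansive ::
    "'a::real_normed_vector set \<Rightarrow> 'a set \<Rightarrow> ('a \<Rightarrow> 'a) \<Rightarrow> bool" where
  "relatively_orbital_nonexpansive A B T \<longleftrightarrow>
    cyclic_map A B T \<and>
    (\<forall>x\<in>A. \<forall>y\<in>B. norm (x - y) = setdist A B \<longrightarrow> norm (T x - T y) = setdist A B) \<and>
    (\<forall>x\<in>A. \<forall>y\<in>B.
      ereal (norm (T x - T y)) \<le> min (delta_pt x (orbit2 T y)) (delta_pt y (orbit2 T x)))"

definition best_proximity_pair ::
    "'a::real_normed_vector set \<Rightarrow> 'a set \<Rightarrow> ('a \<Rightarrow> 'a) \<Rightarrow> 'a \<Rightarrow> 'a \<Rightarrow> bool" where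
  "best_proximity_pair A B T x y \<longleftrightarrow>
    x \<in> A \<and> y \<in> B \<and> norm (x - T x) = setdist A B \<and> norm (y - T y) = setdist A B"

definition WBPP :: "'a::real_normed_vector set \<Rightarrow> 'a set \<Rightarrow> bool" where
  "WBPP A B \<longleftrightarrow>
    (\<forall>T. relatively_orbital_nonexpansive A B T \<longrightarrow> (\<exists>x y. best_proximity_pair A B T x y))"

end

theory Submission
  imports Defs
begin

text \<open>
  The map \<open>S (x, y) = (T y, T x)\<close> sends the set \<open>W\<close> of all pairs in \<open>A \<times> B\<close> at distance
  \<open>d(A,B)\<close> to itself. This \<open>W\<close> is convex, and it is compact in the product of the weak
  topologies, because the norm is weakly lower semicontinuous
  (\<open>closedin_norm_fst_diff_snd\<close>). Zorn's lemma therefore yields a minimal non-empty closed convex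
  \<open>S\<close>-invariant set \<open>H \<subseteq> W\<close> (\<open>minimal_invariant_exists\<close>). Its projections \<open>H1\<close> and \<open>H2\<close> form
  a proximinal pair at distance \<open>d(A,B)\<close>, and \<open>T\<close> is cyclic on them. Working with subsets of \<open>W\<close>
  instead of pairs of sets keeps track of the proximal partners automatically.

  The heart of the matter is that \<open>\<delta>(H1,H2) = d(A,B)\<close> (\<open>minimal_invariant_delta_le\<close>). Otherwise
  normal structure gives \<open>x \<in> H1\<close> and \<open>y \<in> H2\<close> whose radii \<open>\<delta>(x,H2)\<close> and \<open>\<delta>(y,H1)\<close> are less than
  \<open>\<delta>(H1,H2)\<close>. The points \<open>x\<close> and \<open>y\<close> need not be partners, but if \<open>y'\<close> is a partner of \<open>x\<close> and
  \<open>x'\<close> one of \<open>y\<close>, then the midpoint of \<open>(x,y')\<close> and \<open>(x',y)\<close> lies in \<open>H\<close>, and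
  both its components still have radius at most some \<open>s < \<delta>(H1,H2)\<close>. The set \<open>L\<close> of all \<open>(u,v) \<in> H\<close>
  with this property is closed and convex. It is also invariant: the orbits
  \<open>O\<^sup>2(b)\<close> with \<open>b \<in> H2\<close> stay in \<open>H2\<close>, so \<open>\<parallel>T u - T b\<parallel> \<le> \<delta>(u,H2) \<le> s\<close>; hence the ball of
  radius \<open>s\<close> about \<open>T u\<close> contains \<open>T(H2)\<close>, and by minimality of \<open>H\<close> it contains \<open>H1\<close>
  (\<open>minimal_invariant_subset\<close>). Symmetrically the ball about \<open>T v\<close> contains \<open>H2\<close>. Minimality now
  forces \<open>L = H\<close>, which contradicts \<open>s < \<delta>(H1,H2)\<close>.

  Consequently any \<open>(x,y) \<in> H\<close> is a best proximity pair, as \<open>T x \<in> H2\<close> and \<open>T y \<in> H1\<close>.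
\<close>

section \<open>Norming functionals\<close>

definition sublinear :: "('a::real_vector \<Rightarrow> real) \<Rightarrow> bool" where
  "sublinear q \<longleftrightarrow>
    (\<forall>x y. q (x + y) \<le> q x + q y) \<and> (\<forall>t x. t > 0 \<longrightarrow> q (t *\<^sub>R x) = t * q x)"

lemma sublinear_add: "sublinear q \<Longrightarrow> q (x + y) \<le> q x + q y"
  and sublinear_scale: "sublinear q \<Longrightarrow> t > 0 \<Longrightarrow> q (t *\<^sub>R x) = t * q x"
  by (auto simp: sublinear_def)

lemma sublinear_zero: "sublinear q \<Longrightarrow> q 0 = 0"
  using sublinear_scale[of q 2 0] by simp

lemma sublinear_ge_neg: "sublinear q \<Longrightarrow> - q (- x) \<le> q x"
  using sublinear_add[of q x "- x"] sublinear_zero[of q] by simp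

lemma sublinear_scale_nonneg: "sublinear q \<Longrightarrow> t \<ge> 0 \<Longrightarrow> q (t *\<^sub>R x) = t * q x"
  by (cases "t = 0") (auto simp: sublinear_zero sublinear_scale)

text \<open>
  Oddness turns subadditivity around: \<open>q x = q ((x + y) - y) \<le> q (x + y) - q y\<close>.
\<close>

lemma sublinear_odd_imp_linear:
  assumes q: "sublinear q" and odd: "\<And>x. q (- x) = - q x"
  shows "linear q"
proof (rule linearI)
  fix x y
  have "q x \<le> q (x + y) + q (- y)"
    using sublinear_add[OF q, of "x + y" "- y"] by simp
  then show "q (x + y) = q x + q y"
    using sublinear_add[OF q, of x y] odd[of y] by simp
next
  fix t x
  show "q (t *\<^sub>R x) = t *\<^sub>R q x"
  proof (cases "t \<ge> 0")
    case True
    then show ?thesis by (simp add: sublinear_scale_nonneg[OF q])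
  next
    case False
    then have "q ((- t) *\<^sub>R (- x)) = (- t) * q (- x)"
      by (intro sublinear_scale_nonneg[OF q]) simp
    then show ?thesis by (simp add: odd)
  qed
qed

text \<open>
  Downward directedness is what makes the infimum subadditive: two members \<open>q\<close> and \<open>r\<close> that nearly
  attain the infimum at \<open>x\<close> and at \<open>y\<close> can be replaced by one member below both.
\<close>

lemma sublinear_Inf:
  assumes ne: "C \<noteq> {}" and sub: "\<And>q. q \<in> C \<Longrightarrow> sublinear q"
    and bdd: "\<And>x. bdd_below ((\<lambda>q. q x) ` C)"
    and dir: "\<And>q r. q \<in> C \<Longrightarrow> r \<in> C \<Longrightarrow> \<exists>s\<in>C. s \<le> q \<and> s \<le> r"
  shows "sublinear (\<lambda>x. INF q\<in>C. q x)"
  unfolding sublinear_def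
proof (intro conjI allI impI)
  let ?m = "\<lambda>x. INF q\<in>C. q x"
  fix x y
  have le: "?m (x + y) \<le> q x + r y" if qr: "q \<in> C" "r \<in> C" for q r
  proof -
    obtain s where s: "s \<in> C" "s \<le> q" "s \<le> r" using dir[OF qr] by blast
    have "?m (x + y) \<le> s (x + y)" by (rule cINF_lower[OF bdd s(1)])
    also have "\<dots> \<le> s x + s y" by (rule sublinear_add[OF sub[OF s(1)]])
    also have "\<dots> \<le> q x + r y" using s by (auto simp: le_fun_def intro: add_mono)
    finally show ?thesis .
  qed
  have "?m (x + y) - q x \<le> ?m y" if "q \<in> C" for q
    by (rule cINF_greatest[OF ne]) (use le[OF that] in \<open>simp add: algebra_simps\<close>)
  then have "?m (x + y) - ?m y \<le> ?m x"
    by (intro cINF_greatest[OF ne]) (simp add: algebra_simps)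
  then show "?m (x + y) \<le> ?m x + ?m y" by simp
next
  let ?m = "\<lambda>x. INF q\<in>C. q x"
  fix t :: real and x assume t: "t > 0"
  have le: "?m (s *\<^sub>R z) \<le> s * ?m z" if s: "s > 0" for s z
  proof -
    have "?m (s *\<^sub>R z) / s \<le> q z" if "q \<in> C" for q
      using cINF_lower[OF bdd[of "s *\<^sub>R z"] that] sublinear_scale[OF sub[OF that] s, of z] s
      by (simp add: field_simps)
    then have "?m (s *\<^sub>R z) / s \<le> ?m z" by (intro cINF_greatest[OF ne])
    then show ?thesis using s by (simp add: field_simps)
  qed
  have "?m x \<le> inverse t * ?m (t *\<^sub>R x)" using le[of "inverse t" "t *\<^sub>R x"] t by simp
  then show "?m (t *\<^sub>R x) = t * ?m x" using le[OF t, of x] t by (simp add: field_simps)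
qed

text \<open>
  Tilting lowers a sublinear \<open>q\<close> just enough to make it odd at \<open>z\<close>: the result is again sublinear,
  lies below \<open>q\<close>, and takes at \<open>- z\<close> a value of at most \<open>- q z\<close>. Geometrically it is the largest
  sublinear function below \<open>q\<close> with this bound at \<open>- z\<close>.
\<close>

definition tilt :: "('a::real_vector \<Rightarrow> real) \<Rightarrow> 'a \<Rightarrow> 'a \<Rightarrow> real" where
  "tilt q z x = (INF t\<in>{0..}. q (x + t *\<^sub>R z) - t * q z)"

lemma tilt_le:
  assumes q: "sublinear q" and t: "t \<ge> 0"
  shows "tilt q z x \<le> q (x + t *\<^sub>R z) - t * q z"
  unfolding tilt_def
proof (rule cINF_lower)
  show "bdd_below ((\<lambda>t. q (x + t *\<^sub>R z) - t * q z) ` {0..})"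
  proof (rule bdd_belowI2)
    fix s :: real assume "s \<in> {0..}"
    then show "- q (- x) \<le> q (x + s *\<^sub>R z) - s * q z"
      using sublinear_add[OF q, of "x + s *\<^sub>R z" "- x"]
      by (simp add: sublinear_scale_nonneg[OF q])
  qed
qed (use t in simp)

lemma sublinear_tilt:
  assumes q: "sublinear q"
  shows "sublinear (tilt q z)"
  unfolding sublinear_def
proof (intro conjI allI impI)
  fix x y
  have le: "tilt q z (x + y) \<le> (q (x + s *\<^sub>R z) - s * q z) + (q (y + t *\<^sub>R z) - t * q z)"
    if "s \<ge> 0" "t \<ge> 0" for s t
  proof -
    have "tilt q z (x + y) \<le> q (x + y + (s + t) *\<^sub>R z) - (s + t) * q z"
      using that by (intro tilt_le[OF q]) simp
    moreover have "x + y + (s + t) *\<^sub>R z = (x + s *\<^sub>R z) + (y + t *\<^sub>R z)"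
      by (simp add: algebra_simps)
    ultimately show ?thesis
      using sublinear_add[OF q, of "x + s *\<^sub>R z" "y + t *\<^sub>R z"] by (simp add: algebra_simps)
  qed
  have "tilt q z (x + y) - (q (x + s *\<^sub>R z) - s * q z) \<le> tilt q z y" if "s \<ge> 0" for s
    unfolding tilt_def[of q z y]
    by (rule cINF_greatest) (use le[OF that] in \<open>auto simp: algebra_simps\<close>)
  then have "tilt q z (x + y) - tilt q z y \<le> tilt q z x"
    unfolding tilt_def[of q z x] by (intro cINF_greatest) (auto simp: algebra_simps)
  then show "tilt q z (x + y) \<le> tilt q z x + tilt q z y" by simp
next
  have le: "tilt q z (s *\<^sub>R w) \<le> s * tilt q z w" if s: "s > 0" for s w
  proof -
    have "tilt q z (s *\<^sub>R w) / s \<le> tilt q z w"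
      unfolding tilt_def[of q z w]
    proof (rule cINF_greatest)
      fix t :: real assume "t \<in> {0..}"
      then have "tilt q z (s *\<^sub>R w) \<le> q (s *\<^sub>R w + (s * t) *\<^sub>R z) - (s * t) * q z"
        using s by (intro tilt_le[OF q]) simp
      also have "s *\<^sub>R w + (s * t) *\<^sub>R z = s *\<^sub>R (w + t *\<^sub>R z)"
        by (simp add: scaleR_add_right)
      also have "q \<dots> = s * q (w + t *\<^sub>R z)" by (rule sublinear_scale[OF q s])
      finally show "tilt q z (s *\<^sub>R w) / s \<le> q (w + t *\<^sub>R z) - t * q z"
        using s by (simp add: field_simps)
    qed simp
    then show ?thesis using s by (simp add: field_simps)
  qed
  fix t :: real and x assume t: "t > 0"
  have "tilt q z x \<le> inverse t * tilt q z (t *\<^sub>R x)" using le[of "inverse t" "t *\<^sub>R x"] t by simp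
  then show "tilt q z (t *\<^sub>R x) = t * tilt q z x" using le[OF t, of x] t by (simp add: field_simps)
qed

lemma tilt_le_self: "sublinear q \<Longrightarrow> tilt q z \<le> q"
  using tilt_le[of q 0 z] by (auto simp: le_fun_def)

lemma tilt_minus: "sublinear q \<Longrightarrow> tilt q z (- z) \<le> - q z"
  using tilt_le[of q 1 z "- z"] by (simp add: sublinear_zero)

text \<open>
  This is the Hahn-Banach theorem in a form that needs no extension from subspaces: a minimal
  sublinear function coincides with all its tilts, so it is odd and therefore linear.
\<close>

lemma linear_below_sublinear:
  assumes p: "sublinear p"
  shows "\<exists>f. linear f \<and> f \<le> p"
proof -
  let ?A = "{q. sublinear q \<and> q \<le> p}"
  let ?R = "relation_of (\<lambda>q r. r \<le> q) ?A"
  have "\<exists>m\<in>?A. \<forall>q\<in>?A. q \<le> m \<longrightarrow> q = m"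
  proof (rule predicate_Zorn)
    show "partial_order_on ?A ?R"
      by (rule partial_order_on_relation_ofI) auto
  next
    fix C assume "C \<in> Chains ?R"
    then have C: "C \<subseteq> ?A" and chain: "\<And>q r. q \<in> C \<Longrightarrow> r \<in> C \<Longrightarrow> q \<le> r \<or> r \<le> q"
      by (auto simp: Chains_def relation_of_def)
    show "\<exists>u\<in>?A. \<forall>q\<in>C. u \<le> q"
    proof (cases "C = {}")
      case True
      then show ?thesis using p by auto
    next
      case False
      have bdd: "bdd_below ((\<lambda>q. q x) ` C)" for x
      proof (rule bdd_belowI2)
        fix q assume "q \<in> C"
        then have "sublinear q" "q (- x) \<le> p (- x)" using C by (auto simp: le_fun_def)
        then show "- p (- x) \<le> q x" using sublinear_ge_neg[of q x] by simp
      qed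
      let ?m = "\<lambda>x. INF q\<in>C. q x"
      have le: "?m \<le> q" if "q \<in> C" for q
        using cINF_lower[OF bdd that] by (simp add: le_fun_def)
      have "sublinear ?m"
      proof (rule sublinear_Inf)
        show "\<exists>s\<in>C. s \<le> q \<and> s \<le> r" if "q \<in> C" "r \<in> C" for q r
          using chain[OF that] that by blast
      qed (use False C bdd in auto)
      moreover have "?m \<le> p"
        using False C le by (blast intro: order_trans)
      ultimately show ?thesis using le by blast
    qed
  qed
  then obtain m where m: "sublinear m" "m \<le> p"
    and min: "\<And>q. sublinear q \<Longrightarrow> q \<le> m \<Longrightarrow> q = m"
    by (auto intro: order_trans)
  have "m (- z) = - m z" for z
  proof -
    have "tilt m z = m" by (intro min sublinear_tilt tilt_le_self m)
    then have "m (- z) \<le> - m z" using tilt_minus[OF m(1), of z] by simp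
    then show ?thesis using sublinear_ge_neg[OF m(1), of z] by simp
  qed
  then show ?thesis using sublinear_odd_imp_linear[OF m(1)] m(2) by blast
qed

text \<open>
  Every linear functional below the norm tilted at \<open>z\<close> satisfies \<open>f (- z) \<le> - \<parallel>z\<parallel>\<close>, hence it
  attains the norm at \<open>z\<close>.
\<close>

lemma norming_functional:
  fixes z :: "'a::real_normed_vector"
  shows "\<exists>f :: 'a \<Rightarrow> real. bounded_linear f \<and> (\<forall>x. f x \<le> norm x) \<and> f z = norm z"
proof -
  have sub: "sublinear (norm :: 'a \<Rightarrow> real)"
    by (simp add: sublinear_def norm_triangle_ineq)
  obtain f where f: "linear f" "f \<le> tilt norm z"
    using linear_below_sublinear[OF sublinear_tilt[OF sub]] by blast
  have le: "f x \<le> norm x" for x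
    using f(2) tilt_le_self[OF sub, of z] by (meson le_fun_def order_trans)
  have "norm (f x) \<le> norm x * 1" for x
    using le[of x] le[of "- x"] linear_neg[OF f(1), of x] by simp
  then have "bounded_linear f"
    using f(1) unfolding bounded_linear_def bounded_linear_axioms_def by blast
  moreover have "f z = norm z"
    using tilt_minus[OF sub, of z] f(2) linear_neg[OF f(1), of z] le[of z]
    by (smt (verit, best) le_fun_def)
  ultimately show ?thesis using le by blast
qed

section \<open>The weak topology\<close>

lemma topspace_weak_topology [simp]:
  "topspace (weak_topology :: 'a::real_normed_vector topology) = UNIV"
proof -
  have "(\<lambda>x::'a. 0::real) -` UNIV \<in>
      {f -` U | (f :: 'a \<Rightarrow> real) U. bounded_linear f \<and> open U}"
    using bounded_linear_zero open_UNIV by blast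
  then show ?thesis
    unfolding weak_topology_def topology_generated_by_topspace by auto
qed

lemma continuous_map_weak_functional:
  fixes f :: "'a::real_normed_vector \<Rightarrow> real"
  assumes "bounded_linear f"
  shows "continuous_map weak_topology euclideanreal f"
proof -
  have "openin weak_topology (f -` U)" if "open U" for U
    unfolding weak_topology_def
    by (rule topology_generated_by_Basis) (use assms that in blast)
  then show ?thesis by (auto simp: continuous_map_def vimage_def)
qed

text \<open>
  Weak lower semicontinuity of the norm. By norming functionals the condition \<open>\<parallel>g p\<parallel> \<le> r\<close> is the
  conjunction of the closed conditions \<open>f (g p) \<le> r\<close>. Leaving \<open>X\<close> and \<open>g\<close> arbitrary covers
  differences of components of a pair and distances to a fixed point alike.
\<close>

lemma closedin_norm_le:
  assumes cont: "\<And>f :: 'a::real_normed_vector \<Rightarrow> real. bounded_linear f \<Longrightarrow>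
      continuous_map X euclideanreal (\<lambda>p. f (g p))"
  shows "closedin X {p \<in> topspace X. norm (g p) \<le> r}"
proof -
  let ?F = "{f :: 'a \<Rightarrow> real. bounded_linear f \<and> (\<forall>x. f x \<le> norm x)}"
  have ne: "?F \<noteq> {}" using norming_functional by blast
  have "norm v \<le> r \<longleftrightarrow> (\<forall>f\<in>?F. f v \<le> r)" for v
  proof
    assume "\<forall>f\<in>?F. f v \<le> r"
    then show "norm v \<le> r" using norming_functional[of v] by auto
  qed (auto intro: order_trans)
  then have "{p \<in> topspace X. norm (g p) \<le> r} =
      (\<Inter>f\<in>?F. {p \<in> topspace X. f (g p) \<in> {..r}})"
    using ne by auto
  moreover have "closedin X {p \<in> topspace X. f (g p) \<in> {..r}}" if "f \<in> ?F" for f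
    by (rule closedin_continuous_map_preimage[OF cont]) (use that in auto)
  ultimately show ?thesis
    using ne by (auto intro!: closedin_Inter)
qed

lemma Hausdorff_weak_topology: "Hausdorff_space (weak_topology :: 'a::real_normed_vector topology)"
  unfolding Hausdorff_space_def
proof (intro allI impI)
  fix x y :: 'a
  assume "x \<in> topspace weak_topology \<and> y \<in> topspace weak_topology \<and> x \<noteq> y"
  then have "x \<noteq> y" by simp
  obtain f where f: "bounded_linear f" "f (x - y) = norm (x - y)"
    using norming_functional by blast
  then have "f x \<noteq> f y"
    using \<open>x \<noteq> y\<close> by (metis bounded_linear.linear linear_diff norm_eq_zero right_minus_eq)
  then obtain U V where UV: "open U" "open V" "f x \<in> U" "f y \<in> V" "U \<inter> V = {}"
    using hausdorff[OF \<open>f x \<noteq> f y\<close>] by blast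
  have "openin weak_topology (f -` W)" if "open W" for W
    using openin_continuous_map_preimage[OF continuous_map_weak_functional[OF f(1)], of W] that
    by (simp add: vimage_def)
  then show "\<exists>U V. openin weak_topology U \<and> openin weak_topology V \<and>
      x \<in> U \<and> y \<in> V \<and> disjnt U V"
    using UV by (intro exI[of _ "f -` U"] exI[of _ "f -` V"]) (auto simp: disjnt_def)
qed

abbreviation weak_square :: "('a::real_normed_vector \<times> 'a) topology" where
  "weak_square \<equiv> prod_topology weak_topology weak_topology"

lemma continuous_map_weak_square_functional:
  fixes f :: "'a::real_normed_vector \<Rightarrow> real"
  assumes "bounded_linear f"
  shows "continuous_map weak_square euclideanreal (\<lambda>p. f (fst p))"
    and "continuous_map weak_square euclideanreal (\<lambda>p. f (snd p))"
  using continuous_map_compose[OF continuous_map_fst continuous_map_weak_functional[OF assms]]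
    continuous_map_compose[OF continuous_map_snd continuous_map_weak_functional[OF assms]]
  by (simp_all add: o_def)

lemma closedin_weak_square:
  fixes b :: "'a::real_normed_vector"
  shows closedin_norm_fst_diff_snd: "closedin weak_square {p :: 'a \<times> 'a. norm (fst p - snd p) \<le> r}"
    and closedin_vimage_fst_cball: "closedin weak_square (fst -` cball b r)"
    and closedin_vimage_snd_cball: "closedin weak_square (snd -` cball b r)"
proof -
  note cont = continuous_map_weak_square_functional
  have "closedin weak_square {p \<in> topspace weak_square. norm (fst p - snd p :: 'a) \<le> r}"
  proof (rule closedin_norm_le)
    fix f :: "'a \<Rightarrow> real" assume f: "bounded_linear f"
    show "continuous_map weak_square euclideanreal (\<lambda>p. f (fst p - snd p))"
      unfolding linear_diff[OF bounded_linear.linear[OF f]]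
      by (intro continuous_map_diff cont[OF f])
  qed
  then show "closedin weak_square {p :: 'a \<times> 'a. norm (fst p - snd p) \<le> r}" by simp
  have "closedin weak_square {p \<in> topspace weak_square. norm (b - fst p) \<le> r}"
  proof (rule closedin_norm_le)
    fix f :: "'a \<Rightarrow> real" assume f: "bounded_linear f"
    show "continuous_map weak_square euclideanreal (\<lambda>p. f (b - fst p))"
      unfolding linear_diff[OF bounded_linear.linear[OF f]]
      by (intro continuous_map_diff cont[OF f]) simp
  qed
  then show "closedin weak_square (fst -` cball b r)" by (simp add: vimage_def dist_norm)
  have "closedin weak_square {p \<in> topspace weak_square. norm (b - snd p) \<le> r}"
  proof (rule closedin_norm_le)
    fix f :: "'a \<Rightarrow> real" assume f: "bounded_linear f"
    show "continuous_map weak_square euclideanreal (\<lambda>p. f (b - snd p))"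
      unfolding linear_diff[OF bounded_linear.linear[OF f]]
      by (intro continuous_map_diff cont[OF f]) simp
  qed
  then show "closedin weak_square (snd -` cball b r)" by (simp add: vimage_def dist_norm)
qed

section \<open>Minimal invariant sets\<close>

text \<open>
  The topology is an explicit argument, since it will be the weak one and not that of the type.
\<close>

definition invariant_in :: "'b::real_vector topology \<Rightarrow> 'b set \<Rightarrow> ('b \<Rightarrow> 'b) \<Rightarrow> 'b set \<Rightarrow> bool" where
  "invariant_in X W S H \<longleftrightarrow> H \<subseteq> W \<and> H \<noteq> {} \<and> closedin X H \<and> convex H \<and> S ` H \<subseteq> H"

definition minimal_invariant_in ::
    "'b::real_vector topology \<Rightarrow> 'b set \<Rightarrow> ('b \<Rightarrow> 'b) \<Rightarrow> 'b set \<Rightarrow> bool" where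
  "minimal_invariant_in X W S H \<longleftrightarrow>
    invariant_in X W S H \<and> (\<forall>K. invariant_in X W S K \<and> K \<subseteq> H \<longrightarrow> K = H)"

lemma minimal_invariant_exists:
  assumes W: "compactin X W" "invariant_in X W S W"
  shows "\<exists>H. minimal_invariant_in X W S H"
proof -
  let ?A = "Collect (invariant_in X W S)"
  let ?R = "relation_of (\<lambda>H K. K \<subseteq> H) ?A"
  have "\<exists>m\<in>?A. \<forall>K\<in>?A. K \<subseteq> m \<longrightarrow> K = m"
  proof (rule predicate_Zorn)
    show "partial_order_on ?A ?R"
      by (rule partial_order_on_relation_ofI) auto
  next
    fix C assume "C \<in> Chains ?R"
    then have C: "\<And>H. H \<in> C \<Longrightarrow> invariant_in X W S H"
      and chain: "\<And>H K. H \<in> C \<Longrightarrow> K \<in> C \<Longrightarrow> H \<subseteq> K \<or> K \<subseteq> H"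
      by (auto simp: Chains_def relation_of_def)
    show "\<exists>u\<in>?A. \<forall>H\<in>C. u \<subseteq> H"
    proof (cases "C = {}")
      case True
      then show ?thesis using W by auto
    next
      case False
      have "W \<inter> \<Inter>\<F> \<noteq> {}" if "finite \<F>" "\<F> \<subseteq> C" for \<F>
      proof (cases "\<F> = {}")
        case True
        then show ?thesis using W by (simp add: invariant_in_def)
      next
        case ne: False
        have "\<Inter>\<F> \<in> \<F>"
          by (rule finite_Inf_in[OF that(1) ne]) (use that(2) chain in \<open>metis subsetD inf.absorb1 inf.absorb2\<close>)
        then have "invariant_in X W S (\<Inter>\<F>)" using that(2) C by blast
        then show ?thesis unfolding invariant_in_def by blast
      qed
      moreover have closed: "\<forall>H\<in>C. closedin X H"
        using C by (simp add: invariant_in_def)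
      ultimately have "W \<inter> \<Inter>C \<noteq> {}"
        using W(1)[unfolded compactin_fip] by simp
      moreover have "\<Inter>C \<subseteq> W" "S ` \<Inter>C \<subseteq> \<Inter>C"
        using C False unfolding invariant_in_def by fast+
      moreover have "closedin X (\<Inter>C)"
        using False closed by (intro closedin_Inter) auto
      moreover have "convex (\<Inter>C)"
        using C by (intro convex_Inter) (auto simp: invariant_in_def)
      ultimately have "invariant_in X W S (\<Inter>C)"
        unfolding invariant_in_def by blast
      then show ?thesis by blast
    qed
  qed
  then show ?thesis unfolding minimal_invariant_in_def by blast
qed

text \<open>
  A minimal invariant set is the closed convex hull of its image under \<open>S\<close>. The form below avoids
  hulls: \<open>H \<inter> F\<close> is itself invariant, because \<open>S\<close> maps it into \<open>S ` H \<subseteq> H \<inter> F\<close>.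
\<close>

lemma minimal_invariant_subset:
  assumes "minimal_invariant_in X W S H" "closedin X F" "convex F" "S ` H \<subseteq> F"
  shows "H \<subseteq> F"
proof -
  have H: "invariant_in X W S H" using assms(1) by (simp add: minimal_invariant_in_def)
  have "invariant_in X W S (H \<inter> F)"
    using H assms(2-4) unfolding invariant_in_def
    by (intro conjI closedin_Int convex_Int) blast+
  then have "H \<inter> F = H" using assms(1) unfolding minimal_invariant_in_def by blast
  then show ?thesis by blast
qed

section \<open>Best proximity pairs\<close>

lemma delta_pt_le_iff: "delta_pt x S \<le> ereal r \<longleftrightarrow> (\<forall>y\<in>S. norm (x - y) \<le> r)"
  by (simp add: delta_pt_def SUP_le_iff)

lemma delta_le_iff: "delta A B \<le> ereal r \<longleftrightarrow> (\<forall>x\<in>A. \<forall>y\<in>B. norm (x - y) \<le> r)"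
  by (auto simp: delta_def SUP_le_iff)

lemma orbit2_subset:
  assumes "T ` H1 \<subseteq> H2" "T ` H2 \<subseteq> H1" "x \<in> H1"
  shows "orbit2 T x \<subseteq> H1"
proof -
  have "(T ^^ (2 * n)) x \<in> H1" for n
    by (induction n) (use assms in auto)
  then show ?thesis by (auto simp: orbit2_def)
qed

lemma convex_norm_fst_diff_snd:
  "convex {p :: 'a::real_normed_vector \<times> 'a. norm (fst p - snd p) \<le> r}"
proof -
  have "linear (\<lambda>p :: 'a \<times> 'a. fst p - snd p)"
    by (intro linear_compose_sub linear_fst linear_snd)
  then have "convex ((\<lambda>p :: 'a \<times> 'a. fst p - snd p) -` cball 0 r)"
    by (intro convex_linear_vimage convex_cball)
  then show ?thesis by (simp add: vimage_def)
qed

lemma norm_midpoint_diff_le: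
  fixes x x' b :: "'a::real_normed_vector"
  assumes "norm (x - b) \<le> c" "norm (x' - b) \<le> e"
  shows "norm ((1/2) *\<^sub>R x + (1/2) *\<^sub>R x' - b) \<le> (c + e) / 2"
proof -
  have "(1/2) *\<^sub>R x + (1/2) *\<^sub>R x' - b = (1/2) *\<^sub>R (x - b) + (1/2) *\<^sub>R (x' - b)"
    by (simp add: algebra_simps flip: scaleR_add_left)
  also have "norm \<dots> \<le> norm (x - b) / 2 + norm (x' - b) / 2"
    by (rule norm_triangle_le) simp
  finally show ?thesis using assms by simp
qed

text \<open>
  If \<open>\<delta>(H1,H2)\<close> exceeded \<open>d(A,B)\<close>, normal structure would provide a point of \<open>H\<close> with small radii;
  the points of \<open>H\<close> with equally small radii would then form a smaller invariant set.
\<close>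

lemma minimal_invariant_delta_le:
  fixes A B :: "'a::real_normed_vector set"
  assumes T: "relatively_orbital_nonexpansive A B T"
    and normal: "weak_proximal_normal_structure A B"
    and compact: "compactin weak_square (A \<times> B)"
    and min: "minimal_invariant_in weak_square {p \<in> A \<times> B. norm (fst p - snd p) \<le> setdist A B}
      (\<lambda>(x, y). (T y, T x)) H"
  shows "delta (fst ` H) (snd ` H) \<le> ereal (setdist A B)"
proof (rule ccontr)
  define d where "d = setdist A B"
  define W where "W = {p \<in> A \<times> B. norm (fst p - snd p) \<le> d}"
  define S where "S = (\<lambda>(x, y). (T y, T x))"
  define H1 H2 where "H1 = fst ` H" and "H2 = snd ` H"
  assume "\<not> delta (fst ` H) (snd ` H) \<le> ereal (setdist A B)"
  then have big: "delta H1 H2 > ereal d" by (simp add: H1_def H2_def d_def)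
  have min: "minimal_invariant_in weak_square W S H"
    using min by (simp add: W_def S_def d_def)
  then have inv: "invariant_in weak_square W S H" by (simp add: minimal_invariant_in_def)
  then have HW: "H \<subseteq> W" and ne: "H \<noteq> {}" and cl: "closedin weak_square H"
    and conv: "convex H" and SH: "S ` H \<subseteq> H"
    by (auto simp: invariant_in_def)
  have sub: "H1 \<subseteq> A" "H2 \<subseteq> B" using HW by (auto simp: H1_def H2_def W_def)
  have memI: "x \<in> H1" "y \<in> H2" if "(x, y) \<in> H" for x y
    using that by (force simp: H1_def H2_def)+
  have T12: "T ` H1 \<subseteq> H2" and T21: "T ` H2 \<subseteq> H1"
    using SH by (force simp: H1_def H2_def S_def)+
  have cpt: "compactin weak_square H"
    by (rule closed_compactin[OF compact _ cl]) (use HW in \<open>auto simp: W_def\<close>)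
  have wc: "weakly_compact H1" "weakly_compact H2"
    unfolding weakly_compact_def H1_def H2_def
    using image_compactin[OF cpt continuous_map_fst] image_compactin[OF cpt continuous_map_snd]
    by auto
  have cv: "convex H1" "convex H2"
    unfolding H1_def H2_def
    by (auto intro: convex_linear_image conv linear_fst linear_snd)
  have dge: "d \<le> norm (x - y)" if "x \<in> A" "y \<in> B" for x y
    using setdist_le_dist[OF that] by (simp add: d_def dist_norm)
  have near: "norm (x - y) = d" if "(x, y) \<in> H" for x y
    using that HW dge[of x y] by (force simp: W_def)
  have sd: "setdist H1 H2 = d"
  proof (rule antisym)
    obtain x y where xy: "(x, y) \<in> H" using ne by auto
    show "setdist H1 H2 \<le> d"
      using setdist_le_dist[OF memI[OF xy]] near[OF xy] by (simp add: dist_norm)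
    show "d \<le> setdist H1 H2"
      using ne sub dge by (intro le_setdistI) (auto simp: dist_norm H1_def H2_def)
  qed
  have prox: "proximinal_pair H1 H2"
    unfolding proximinal_pair_def sd
  proof (intro conjI ballI)
    fix x assume "x \<in> H1"
    then obtain y where "(x, y) \<in> H" by (auto simp: H1_def)
    then show "\<exists>y\<in>H2. norm (x - y) = d" using memI near by blast
  next
    fix y assume "y \<in> H2"
    then obtain x where "(x, y) \<in> H" by (auto simp: H2_def)
    then show "\<exists>x\<in>H1. norm (y - x) = d" using memI near by (metis norm_minus_commute)
  qed
  have ne12: "H1 \<noteq> {}" "H2 \<noteq> {}" using ne by (auto simp: H1_def H2_def)
  obtain x y where x: "x \<in> H1" "delta_pt x H2 < delta H1 H2"
    and y: "y \<in> H2" "delta_pt y H1 < delta H1 H2"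
    using normal[unfolded weak_proximal_normal_structure_def] sub ne12 wc cv prox sd big
    unfolding d_def by metis
  obtain c where c: "ereal c < delta H1 H2"
    and xc: "\<And>b. b \<in> H2 \<Longrightarrow> norm (x - b) \<le> c" and yc: "\<And>a. a \<in> H1 \<Longrightarrow> norm (y - a) \<le> c"
  proof -
    obtain c1 where c1: "delta_pt x H2 < ereal c1" "ereal c1 < delta H1 H2"
      using ereal_dense2[OF x(2)] by blast
    obtain c2 where c2: "delta_pt y H1 < ereal c2" "ereal c2 < delta H1 H2"
      using ereal_dense2[OF y(2)] by blast
    show ?thesis
    proof (rule that[of "max c1 c2"])
      show "ereal (max c1 c2) < delta H1 H2" using c1 c2 by (auto simp: max_def)
      show "norm (x - b) \<le> max c1 c2" if "b \<in> H2" for b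
        using less_imp_le[OF c1(1)] that by (auto simp: delta_pt_le_iff max_def intro: order_trans)
      show "norm (y - a) \<le> max c1 c2" if "a \<in> H1" for a
        using less_imp_le[OF c2(1)] that by (auto simp: delta_pt_le_iff max_def intro: order_trans)
    qed
  qed
  \<comment> \<open>Having a point of finite radius on each side already bounds the pair, so \<open>\<delta>(H1,H2)\<close> is
      finite and can be averaged with \<open>c\<close>.\<close>
  have "norm (a - b) \<le> 3 * c" if "a \<in> H1" "b \<in> H2" for a b
    using norm_triangle_ineq[of "a - y" "y - b"] norm_triangle_ineq[of "y - x" "x - b"]
      yc[OF that(1)] xc[OF that(2)] xc[OF y(1)]
    by (simp add: norm_minus_commute)
  then have "delta H1 H2 \<le> ereal (3 * c)" by (simp add: delta_le_iff)
  then obtain D where D: "delta H1 H2 = ereal D"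
    using c by (cases "delta H1 H2") auto
  have Dle: "norm (a - b) \<le> D" if "a \<in> H1" "b \<in> H2" for a b
    using delta_le_iff[of H1 H2 D] D that by auto
  define s where "s = (c + D) / 2"
  have "s < D" using c D by (simp add: s_def)
  define L where "L = H \<inter> (\<Inter>b\<in>H2. fst -` cball b s) \<inter> (\<Inter>a\<in>H1. snd -` cball a s)"
  have L_iff: "p \<in> L \<longleftrightarrow> p \<in> H \<and> (\<forall>b\<in>H2. norm (fst p - b) \<le> s) \<and> (\<forall>a\<in>H1. norm (snd p - a) \<le> s)"
    for p by (auto simp: L_def dist_norm norm_minus_commute)
  have "L \<noteq> {}"
  proof -
    \<comment> \<open>The partners \<open>x'\<close> and \<open>y'\<close> have radius at most \<open>D\<close>, and \<open>x\<close> and \<open>y\<close> have radius at most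
        \<open>c\<close>; the midpoint averages the two bounds.\<close>
    obtain y' where y': "(x, y') \<in> H" using x by (auto simp: H1_def)
    obtain x' where x': "(x', y) \<in> H" using y by (auto simp: H2_def)
    have "(1/2) *\<^sub>R (x, y') + (1/2) *\<^sub>R (x', y) \<in> H"
      using y' x' by (intro convexD[OF conv]) auto
    then have "((1/2) *\<^sub>R x + (1/2) *\<^sub>R x', (1/2) *\<^sub>R y' + (1/2) *\<^sub>R y) \<in> H" by simp
    moreover have "norm ((1/2) *\<^sub>R x + (1/2) *\<^sub>R x' - b) \<le> s" if "b \<in> H2" for b
      unfolding s_def by (intro norm_midpoint_diff_le xc Dle that memI[OF x'])
    moreover have "norm ((1/2) *\<^sub>R y' + (1/2) *\<^sub>R y - a) \<le> s" if "a \<in> H1" for a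
      using norm_midpoint_diff_le[OF yc[OF that], of y' D] Dle[OF that memI(2)[OF y']]
      by (simp add: s_def add.commute norm_minus_commute)
    ultimately have "((1/2) *\<^sub>R x + (1/2) *\<^sub>R x', (1/2) *\<^sub>R y' + (1/2) *\<^sub>R y) \<in> L"
      unfolding L_iff fst_conv snd_conv by blast
    then show ?thesis by blast
  qed
  moreover have "closedin weak_square L"
    unfolding L_def
    by (intro closedin_Int cl closedin_INT closedin_vimage_fst_cball closedin_vimage_snd_cball ne12)
  moreover have "convex L"
    unfolding L_def
    by (intro convex_Int convex_INT conv convex_linear_vimage linear_fst linear_snd convex_cball)
  moreover have "S ` L \<subseteq> L"
  proof (rule image_subsetI)
    fix p assume "p \<in> L"
    obtain u v where p: "p = (u, v)" by (cases p)
    have uv: "(u, v) \<in> H" and us: "\<And>b. b \<in> H2 \<Longrightarrow> norm (u - b) \<le> s"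
      and vs: "\<And>a. a \<in> H1 \<Longrightarrow> norm (v - a) \<le> s"
      using \<open>p \<in> L\<close> by (auto simp: L_iff p)
    note uH = memI(1)[OF uv] and vH = memI(2)[OF uv]
    have orb: "norm (T a - T b) \<le> r"
      if "a \<in> H1" "b \<in> H2" "(\<forall>w\<in>H2. norm (a - w) \<le> r) \<or> (\<forall>w\<in>H1. norm (b - w) \<le> r)" for a b r
    proof -
      have "ereal (norm (T a - T b)) \<le> min (delta_pt a (orbit2 T b)) (delta_pt b (orbit2 T a))"
        using T subsetD[OF sub(1) that(1)] subsetD[OF sub(2) that(2)]
        unfolding relatively_orbital_nonexpansive_def by blast
      moreover have "orbit2 T b \<subseteq> H2" "orbit2 T a \<subseteq> H1"
        using orbit2_subset[OF T21 T12 that(2)] orbit2_subset[OF T12 T21 that(1)] by auto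
      then have "delta_pt a (orbit2 T b) \<le> ereal r \<or> delta_pt b (orbit2 T a) \<le> ereal r"
        using that(3) unfolding delta_pt_le_iff by blast
      ultimately have "ereal (norm (T a - T b)) \<le> ereal r"
        unfolding min.bounded_iff by (blast intro: order_trans)
      then show ?thesis by simp
    qed
    \<comment> \<open>The estimate \<open>orb\<close> controls the distance from \<open>T u\<close> to \<open>T(H2)\<close> only; minimality carries it
        over to all of \<open>H1\<close>.\<close>
    have "H \<subseteq> fst -` cball (T u) s"
    proof (rule minimal_invariant_subset[OF min closedin_vimage_fst_cball])
      show "S ` H \<subseteq> fst -` cball (T u) s"
        using orb[OF uH] us memI by (fastforce simp: S_def dist_norm)
    qed (intro convex_linear_vimage linear_fst convex_cball)
    moreover have "H \<subseteq> snd -` cball (T v) s"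
    proof (rule minimal_invariant_subset[OF min closedin_vimage_snd_cball])
      show "S ` H \<subseteq> snd -` cball (T v) s"
        using orb[OF _ vH] vs memI by (fastforce simp: S_def dist_norm norm_minus_commute)
    qed (intro convex_linear_vimage linear_snd convex_cball)
    moreover have "(T v, T u) \<in> H" using SH uv by (force simp: S_def)
    ultimately show "S p \<in> L"
      by (auto simp: p L_iff S_def H1_def H2_def dist_norm)
  qed
  ultimately have "invariant_in weak_square W S L"
    using HW by (auto simp: invariant_in_def L_iff)
  then have "L = H" using min L_iff by (auto simp: minimal_invariant_in_def)
  then have "delta H1 H2 \<le> ereal s" unfolding delta_le_iff using L_iff by (auto simp: H1_def)
  then show False using D \<open>s < D\<close> by simp
qed

theorem theorem2p5:
  fixes A B :: "'a::banach set"
  assumes "A \<noteq> {}" and "B \<noteq> {}"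
    and "weakly_compact A" and "weakly_compact B"
    and "convex A" and "convex B"
    and "sharp_proximinal_pair A B"
    and "weak_proximal_normal_structure A B"
  shows "WBPP A B"
  unfolding WBPP_def
proof (intro allI impI)
  fix T assume T: "relatively_orbital_nonexpansive A B T"
  define d where "d = setdist A B"
  define W where "W = {p \<in> A \<times> B. norm (fst p - snd p) \<le> d}"
  define S where "S = (\<lambda>(x, y). (T y, T x))"
  have compact: "compactin weak_square (A \<times> B)"
    using assms(3,4) by (simp add: compactin_Times weakly_compact_def)
  have W_Int: "W = (A \<times> B) \<inter> {p. norm (fst p - snd p) \<le> d}" by (auto simp: W_def)
  have "closedin weak_square (A \<times> B)"
    using assms(3,4) unfolding weakly_compact_def closedin_prod_Times_iff
    by (blast intro: compactin_imp_closedin[OF Hausdorff_weak_topology])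
  then have closed: "closedin weak_square W"
    unfolding W_Int by (intro closedin_Int closedin_norm_fst_diff_snd)
  have dge: "d \<le> norm (x - y)" if "x \<in> A" "y \<in> B" for x y
    using setdist_le_dist[OF that] by (simp add: d_def dist_norm)
  have "W \<noteq> {}"
  proof -
    obtain x where x: "x \<in> A" using assms(1) by blast
    then obtain y where "y \<in> B" "norm (x - y) = setdist A B"
      using assms(7) unfolding sharp_proximinal_pair_def by blast
    then show ?thesis using x by (force simp: W_def d_def)
  qed
  moreover have "convex W"
    unfolding W_Int by (intro convex_Int convex_Times assms(5,6) convex_norm_fst_diff_snd)
  moreover have "S ` W \<subseteq> W"
  proof (rule image_subsetI)
    fix p assume "p \<in> W"
    then obtain x y where p: "p = (x, y)" "x \<in> A" "y \<in> B" "norm (x - y) \<le> d"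
      by (auto simp: W_def)
    then have "norm (x - y) = setdist A B" using dge[of x y] by (simp add: d_def)
    then have "norm (T x - T y) = d" "T x \<in> B" "T y \<in> A"
      using T p by (auto simp: relatively_orbital_nonexpansive_def cyclic_map_def d_def)
    then show "S p \<in> W" by (simp add: p S_def W_def norm_minus_commute)
  qed
  ultimately have inv: "invariant_in weak_square W S W"
    using closed by (simp add: invariant_in_def)
  have "compactin weak_square W"
    by (rule closed_compactin[OF compact _ closed]) (auto simp: W_def)
  then obtain H where H: "minimal_invariant_in weak_square W S H"
    using minimal_invariant_exists inv by blast
  have le: "delta (fst ` H) (snd ` H) \<le> ereal d"
    using minimal_invariant_delta_le[OF T assms(8) compact] H by (simp add: W_def S_def d_def)
  obtain x y where xy: "(x, y) \<in> H" "H \<subseteq> W" "S ` H \<subseteq> H"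
    using H by (force simp: minimal_invariant_in_def invariant_in_def)
  then have TH: "(T y, T x) \<in> H" by (force simp: S_def)
  have "norm (x - T x) \<le> d" "norm (T y - y) \<le> d"
    using le xy(1) TH unfolding delta_le_iff by force+
  moreover have "x \<in> A" "y \<in> B" "T x \<in> B" "T y \<in> A" using xy TH by (auto simp: W_def)
  ultimately have "best_proximity_pair A B T x y"
    using dge[of x "T x"] dge[of "T y" y]
    by (simp add: best_proximity_pair_def d_def norm_minus_commute)
  then show "\<exists>x y. best_proximity_pair A B T x y" by blast
qed

end
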